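(* Let $n, d, r, \ell$ be integers with $r \geq 2$ and $0 \leq \ell < d \leq \left\lfloor \frac{n+\ell-1}{2} \right\rfloor$. If $G$ is an $n$-vertex graph with minimum degree $\delta(G) \geq d$ and $G$ is not $\ell$-hamiltonian, then $$N(G, K_r) \leq \max\left\{ h_r(n,d,\ell),\; h_r\left(n, \left\lfloor \tfrac{n+\ell-1}{2} \right\rfloor, \ell\right)\right\}.$$ In particular (the case $r=2$), $$|E(G)| \leq \max\left\{ h(n,d,\ell),\; h\left(n, \left\lfloor \tfrac{n+\ell-1}{2} \right\rfloor, \ell\right)\right\}.$$ Moreover, the bound is sharp for all $0 \leq \ell < d \leq \left\lfloor \frac{n+\ell-1}{2} \right\rfloor$, as shown by the graphs $H_{n,d,\ell}$ and $H_{n,\lfloor (n+\ell-1)/2\rfloor,\ell}$: each of these is an $n$-vertex graph with minimum degree at least $d$ that is not $\ell$-hamiltonian, and one of them contains exactly $\max\left\{ h_r(n,d,\ell), h_r\left(n, \left\lfloor \frac{n+\ell-1}{2} \right\rfloor, \ell\right)\right\}$ copies of $K_r$.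
   Context: All graphs are finite and simple. A linear forest is a graph that is a vertex-disjoint union of paths. For an integer $\ell\ge 0$, a graph $G$ is called $\ell$-hamiltonian if for every linear forest $F$ with exactly $\ell$ edges contained in $G$, $G$ has a hamiltonian cycle containing all edges of $F$ (so $0$-hamiltonian means hamiltonian). $N(G,K_r)$ denotes the number of copies of the complete graph $K_r$ in $G$ (i.e. the number of $r$-element vertex subsets inducing a clique); in particular $N(G,K_2)=|E(G)|$. For integers $0\le \ell<d\le \lfloor (n+\ell-1)/2\rfloor$, the graph $H_{n,d,\ell}$ is the $n$-vertex graph obtained from a copy of $K_{n-d+\ell}$ with vertex set $A$ by adding $d-\ell$ new vertices, each of degree $d$ and each adjacent to exactly the vertices of one common fixed set $B\subseteq A$ with $|B|=d$ (the new vertices are pairwise non-adjacent). The function $h_r$ is defined by $h_r(n,d,\ell) = \binom{n-d+\ell}{r} + (d-\ell)\binom{d}{r-1}$, which equals $N(H_{n,d,\ell},K_r)$, and $h(n,d,\ell) = h_2(n,d,\ell)=\binom{n-d+\ell}{2}+(d-\ell)d$, which equals $|E(H_{n,d,\ell})|$. *)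

theory Defs
  imports Main "HOL-Library.Ramsey" "HOL-Library.Disjoint_Sets"
begin

type_synonym 'a ugraph = "'a set \<times> 'a set set"

abbreviation verts :: "'a ugraph \<Rightarrow> 'a set" where
  "verts G \<equiv> fst G"

abbreviation edges :: "'a ugraph \<Rightarrow> 'a set set" where
  "edges G \<equiv> snd G"

definition simple_graph :: "'a ugraph \<Rightarrow> bool" where
  "simple_graph G \<longleftrightarrow> finite (verts G) \<and> edges G \<subseteq> [verts G]\<^bsup>2\<^esup>"

definition subgraph :: "'a ugraph \<Rightarrow> 'a ugraph \<Rightarrow> bool" where
  "subgraph F G \<longleftrightarrow> verts F \<subseteq> verts G \<and> edges F \<subseteq> edges G"

definition degree :: "'a ugraph \<Rightarrow> 'a \<Rightarrow> nat" where
  "degree G v = card {e \<in> edges G. v \<in> e}"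

text \<open>Only meaningful for graphs with at least one vertex.\<close>

definition min_degree :: "'a ugraph \<Rightarrow> nat" where
  "min_degree G = Min (degree G ` verts G)"

definition num_cliques :: "'a ugraph \<Rightarrow> nat \<Rightarrow> nat" where
  "num_cliques G r = card {K \<in> [verts G]\<^bsup>r\<^esup>. clique K (edges G)}"

definition path_edges :: "'a list \<Rightarrow> 'a set set" where
  "path_edges xs = {{xs ! i, xs ! Suc i} | i. Suc i < length xs}"

definition cycle_edges :: "'a list \<Rightarrow> 'a set set" where
  "cycle_edges xs = insert {last xs, hd xs} (path_edges xs)"

text \<open>A path is represented by the nonempty list of its successive vertices;
  one-vertex paths are allowed, so a linear forest may have isolated vertices.\<close>

definition linear_forest :: "'a ugraph \<Rightarrow> bool" where
  "linear_forest F \<longleftrightarrow>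
     (\<exists>P. finite P \<and> (\<forall>xs\<in>P. xs \<noteq> [] \<and> distinct xs) \<and> disjoint_family_on set P \<and>
          verts F = (\<Union>xs\<in>P. set xs) \<and> edges F = (\<Union>xs\<in>P. path_edges xs))"

definition hamiltonian_cycle :: "'a ugraph \<Rightarrow> 'a list \<Rightarrow> bool" where
  "hamiltonian_cycle G xs \<longleftrightarrow>
     3 \<le> length xs \<and> distinct xs \<and> set xs = verts G \<and> cycle_edges xs \<subseteq> edges G"

definition l_hamiltonian :: "nat \<Rightarrow> 'a ugraph \<Rightarrow> bool" where
  "l_hamiltonian l G \<longleftrightarrow>
     (\<forall>F. linear_forest F \<and> subgraph F G \<and> card (edges F) = l \<longrightarrow>
          (\<exists>xs. hamiltonian_cycle G xs \<and> edges F \<subseteq> cycle_edges xs))"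

text \<open>The graph \<open>H\<^sub>n\<^sub>,\<^sub>d\<^sub>,\<^sub>l\<close>, realised on the vertices \<open>0, \<dots>, n - 1\<close> with
  \<open>A = {..<n - d + l}\<close>, \<open>B = {..<d}\<close> and new vertices \<open>{n - d + l..<n}\<close>.
  It is the intended graph only if \<open>l < d\<close> and \<open>2 * d < n + l\<close>.\<close>

definition H_graph :: "nat \<Rightarrow> nat \<Rightarrow> nat \<Rightarrow> nat ugraph" where
  "H_graph n d l =
     ({..<n}, [{..<n - d + l}]\<^bsup>2\<^esup> \<union> {{s, b} | s b. s \<in> {n - d + l..<n} \<and> b \<in> {..<d}})"

definition h_r :: "nat \<Rightarrow> nat \<Rightarrow> nat \<Rightarrow> nat \<Rightarrow> nat" where
  "h_r r n d l = ((n - d + l) choose r) + (d - l) * (d choose (r - 1))"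

definition h :: "nat \<Rightarrow> nat \<Rightarrow> nat \<Rightarrow> nat" where
  "h n d l = ((n - d + l) choose 2) + (d - l) * d"

end

theory Submission
  imports Defs
begin

text \<open>Let \<open>F\<close> be a linear forest with \<open>l\<close> edges that lies on no hamiltonian cycle of \<open>G\<close>, and add
  edges to \<open>G\<close> as long as this stays true. In the resulting graph, which is not complete, the degrees
  of two nonadjacent vertices add up to at most \<open>n + l - 1\<close> (Ore, Posa). Choose nonadjacent \<open>u\<close>, \<open>v\<close>
  with maximal degree sum and \<open>k = deg u \<le> deg v\<close>. At least \<open>k - l\<close> vertices other than \<open>v\<close> are
  nonadjacent to \<open>v\<close>, and by maximality each of them has degree at most \<open>k\<close>. Counting cliques according
  to whether they meet \<open>k - l\<close> of these vertices gives the bound \<open>h_r(n, k, l)\<close>, which is convex in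
  \<open>k\<close> and hence maximal at an end of the range of \<open>k\<close>.\<close>

section \<open>Paths and cycles as lists\<close>

lemma path_edges_Nil [simp]: "path_edges [] = {}"
  and path_edges_single [simp]: "path_edges [x] = {}"
  by (simp_all add: path_edges_def)

lemma path_edges_Cons:
  assumes "ys \<noteq> []"
  shows "path_edges (x # ys) = insert {x, hd ys} (path_edges ys)"
proof -
  have "path_edges (x # ys) = {{(x # ys) ! i, ys ! i} | i. i < length ys}"
    by (simp add: path_edges_def)
  also have "\<dots> = insert {x, hd ys} (path_edges ys)" (is "?L = ?R")
  proof (intro subset_antisym subsetI)
    fix e assume "e \<in> ?L"
    then obtain i where i: "i < length ys" "e = {(x # ys) ! i, ys ! i}" by blast
    then show "e \<in> ?R"
      by (cases i) (auto simp: path_edges_def hd_conv_nth)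
  next
    fix e assume "e \<in> ?R"
    then consider "e = {(x # ys) ! 0, ys ! 0}"
      | i where "Suc i < length ys" "e = {(x # ys) ! Suc i, ys ! Suc i}"
      using assms by (auto simp: path_edges_def hd_conv_nth)
    then show "e \<in> ?L" using assms by cases blast+
  qed
  finally show ?thesis .
qed

lemma path_edges_append:
  assumes "xs \<noteq> []" "ys \<noteq> []"
  shows "path_edges (xs @ ys) = insert {last xs, hd ys} (path_edges xs \<union> path_edges ys)"
  using assms(1)
proof (induction xs rule: list_nonempty_induct)
  case (single x)
  then show ?case using assms(2) by (simp add: path_edges_Cons)
next
  case (cons x xs)
  then show ?case by (auto simp: path_edges_Cons)
qed

lemma path_edges_rev [simp]: "path_edges (rev xs) = path_edges xs"
proof (induction xs)
  case (Cons x xs)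
  then show ?case
    by (cases "xs = []") (simp_all add: path_edges_append path_edges_Cons last_rev insert_commute)
qed simp

lemma path_edges_subset_append:
  "path_edges xs \<subseteq> path_edges (xs @ ys)" "path_edges ys \<subseteq> path_edges (xs @ ys)"
  by (cases "xs = []"; cases "ys = []"; auto simp: path_edges_append)+

lemma path_edges_subset_concat:
  "xs \<in> set xss \<Longrightarrow> path_edges xs \<subseteq> path_edges (concat xss)"
proof (induction xss)
  case (Cons ys xss)
  then show ?case
    using path_edges_subset_append(1)[of ys "concat xss"]
      path_edges_subset_append(2)[of "concat xss" ys] by auto
qed simp

lemma path_edges_nsets: "distinct xs \<Longrightarrow> path_edges xs \<subseteq> [set xs]\<^bsup>2\<^esup>"
  by (auto simp: path_edges_def nsets_def card_2_iff' nth_eq_iff_index_eq doubleton_eq_iff)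

lemma cycle_edges_nsets:
  assumes "distinct xs" "2 \<le> length xs"
  shows "cycle_edges xs \<subseteq> [set xs]\<^bsup>2\<^esup>"
proof -
  obtain x ys where xs: "xs = x # ys" "ys \<noteq> []"
    using assms(2) by (cases xs; cases "tl xs") auto
  then have "last ys \<noteq> x" using assms(1) by (metis distinct.simps(2) last_in_set)
  then have "{last xs, hd xs} \<in> [set xs]\<^bsup>2\<^esup>"
    using xs by (auto simp: nsets_def)
  then show ?thesis
    using path_edges_nsets[OF assms(1)] by (simp add: cycle_edges_def)
qed

text \<open>Both lists close up through the same two joining edges. This rotation allows a chosen
  vertex or edge to be moved to the ends of the list.\<close>

lemma cycle_edges_append_commute: "cycle_edges (xs @ ys) = cycle_edges (ys @ xs)"
  by (cases "xs = []"; cases "ys = []") (auto simp: cycle_edges_def path_edges_append)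

text \<open>After rotating \<open>v\<close> to the front, only the first edge and the closing edge
  contain \<open>v\<close>.\<close>

lemma card_cycle_edges_at:
  assumes "distinct xs" "3 \<le> length xs" "v \<in> set xs"
  shows "card {e \<in> cycle_edges xs. v \<in> e} = 2"
proof -
  obtain as bs where xs: "xs = as @ v # bs" using assms(3) by (meson split_list)
  define ys where "ys = bs @ as"
  have cyc: "cycle_edges xs = cycle_edges (v # ys)"
    using cycle_edges_append_commute[of as "v # bs"] by (simp add: xs ys_def)
  have ys: "distinct ys" "v \<notin> set ys" "2 \<le> length ys"
    using assms xs by (auto simp: ys_def)
  then have ne: "ys \<noteq> []" by auto
  have nv: "v \<notin> e" if "e \<in> path_edges ys" for e
    using path_edges_nsets[OF ys(1)] that ys(2) by (auto simp: nsets_def)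
  have "{e \<in> cycle_edges xs. v \<in> e} = {{last ys, v}, {v, hd ys}}"
    unfolding cyc using ne nv by (auto simp: cycle_edges_def path_edges_Cons)
  \<comment> \<open>Here length at least 3 matters: it leaves two vertices besides \<open>v\<close>,
    so the two edges at \<open>v\<close> do not coincide.\<close>
  moreover have "last ys \<noteq> hd ys"
  proof -
    obtain y zs where zs: "ys = y # zs" "zs \<noteq> []"
      using ys(3) by (cases ys; cases "tl ys") auto
    then have "last zs \<noteq> y" using ys(1) by (metis distinct.simps(2) last_in_set)
    then show ?thesis using zs by simp
  qed
  moreover have "hd ys \<noteq> v" "last ys \<noteq> v"
    using ne ys(2) by (metis hd_in_set, metis last_in_set)
  ultimately show ?thesis by (auto simp: card_2_iff doubleton_eq_iff)
qed

text \<open>A cycle is connected: starting from a vertex of \<open>W\<close> rotated to the front,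
  membership in \<open>W\<close> spreads along the list edge by edge.\<close>

lemma cycle_closed_set:
  assumes "W \<inter> set xs \<noteq> {}"
    and "\<And>e. e \<in> cycle_edges xs \<Longrightarrow> e \<inter> W \<noteq> {} \<Longrightarrow> e \<subseteq> W"
  shows "set xs \<subseteq> W"
proof -
  obtain v where v: "v \<in> W" "v \<in> set xs" using assms(1) by blast
  then obtain as bs where xs: "xs = as @ v # bs" by (meson split_list)
  have "cycle_edges xs = cycle_edges (v # bs @ as)"
    using cycle_edges_append_commute[of as "v # bs"] by (simp add: xs)
  then have "path_edges (v # bs @ as) \<subseteq> cycle_edges xs"
    by (auto simp: cycle_edges_def)
  then have "\<And>e. e \<in> path_edges (v # bs @ as) \<Longrightarrow> e \<inter> W \<noteq> {} \<Longrightarrow> e \<subseteq> W"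
    using assms(2) by blast
  then have "set (bs @ as) \<subseteq> W"
    using v(1)
  proof (induction "bs @ as" arbitrary: v as bs)
    case (Cons w ws)
    have *: "bs @ as = w # ws" using Cons.hyps(2) by simp
    have "w \<in> W" using Cons.prems(1)[of "{v, w}"] Cons.prems(2)
      by (simp add: * path_edges_Cons)
    \<comment> \<open>The induction hypothesis is about an append, hence the form
      \<open>[] @ ws\<close>; \<open>w\<close> takes over the role of \<open>v\<close>.\<close>
    moreover have "set ([] @ ws) \<subseteq> W"
    proof (rule Cons.hyps(1))
      fix e assume "e \<in> path_edges (w # [] @ ws)" "e \<inter> W \<noteq> {}"
      then show "e \<subseteq> W"
        using Cons.prems(1)[of e] by (simp add: * path_edges_Cons)
    qed (use \<open>w \<in> W\<close> in simp_all)
    ultimately show ?case unfolding * by simp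
  qed auto
  then show ?thesis using v xs by auto
qed

section \<open>Degrees and cliques\<close>

lemma degree_eq_card_neighbours:
  assumes "E \<subseteq> [V]\<^bsup>2\<^esup>"
  shows "degree (V, E) v = card {w. {v, w} \<in> E}"
proof -
  have "{e \<in> E. v \<in> e} = (\<lambda>w. {v, w}) ` {w. {v, w} \<in> E}"
  proof (intro subset_antisym subsetI)
    fix e assume e: "e \<in> {e \<in> E. v \<in> e}"
    then have "card e = 2" using assms by (auto simp: nsets_def)
    then obtain x y where "e = {x, y}" by (auto simp: card_2_iff)
    then show "e \<in> (\<lambda>w. {v, w}) ` {w. {v, w} \<in> E}"
      using e by (cases "x = v") (auto simp: insert_commute)
  qed auto
  moreover have "inj_on (\<lambda>w. {v, w}) {w. {v, w} \<in> E}"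
    by (auto simp: inj_on_def doubleton_eq_iff)
  ultimately show ?thesis by (simp add: degree_def card_image)
qed

text \<open>Makes the bound on edges an instance of the bound on cliques.\<close>

lemma card_edges_eq_num_cliques:
  assumes "simple_graph G"
  shows "card (edges G) = num_cliques G 2"
proof -
  have "K \<in> edges G \<longleftrightarrow> clique K (edges G)" if "K \<in> [verts G]\<^bsup>2\<^esup>" for K
  proof -
    have "card K = 2" using that by (simp add: nsets_def)
    then obtain x y where "K = {x, y}" "x \<noteq> y" by (auto simp: card_2_iff)
    then show ?thesis by (auto simp: clique_def insert_commute)
  qed
  then have "edges G = {K \<in> [verts G]\<^bsup>2\<^esup>. clique K (edges G)}"
    using assms by (auto simp: simple_graph_def)
  then show ?thesis by (simp add: num_cliques_def)
qed

lemma h_eq_h_r: "h n d l = h_r 2 n d l"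
  by (simp add: h_def h_r_def)

lemma num_cliques_mono:
  assumes "finite V" "E \<subseteq> E'"
  shows "num_cliques (V, E) r \<le> num_cliques (V, E') r"
  unfolding num_cliques_def
  using assms by (intro card_mono) (auto simp: clique_def nsets_def)

text \<open>A clique either avoids \<open>D\<close> or consists of some \<open>v\<close> in
  \<open>D\<close> and \<open>s\<close> neighbours of \<open>v\<close>. Cliques meeting
  \<open>D\<close> more than once are overcounted, which is harmless for an upper bound.\<close>

lemma num_cliques_le_low_degree:
  assumes fin: "finite V" and E: "E \<subseteq> [V]\<^bsup>2\<^esup>" and "D \<subseteq> V"
    and deg: "\<And>v. v \<in> D \<Longrightarrow> degree (V, E) v \<le> k"
  shows "num_cliques (V, E) (Suc s) \<le> (card V - card D choose Suc s) + card D * (k choose s)"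
proof -
  define N where "N v = {w. {v, w} \<in> E}" for v
  have NV: "N v \<subseteq> V" for v using E by (auto simp: N_def nsets_def)
  have finN: "finite (N v)" for v using NV fin finite_subset by blast
  have finD: "finite D" using \<open>D \<subseteq> V\<close> fin finite_subset by blast
  have "{K \<in> [V]\<^bsup>Suc s\<^esup>. clique K E} \<subseteq> [V - D]\<^bsup>Suc s\<^esup> \<union> (\<Union>v\<in>D. insert v ` [N v]\<^bsup>s\<^esup>)"
  proof
    fix K assume "K \<in> {K \<in> [V]\<^bsup>Suc s\<^esup>. clique K E}"
    then have K: "K \<subseteq> V" "finite K" "card K = Suc s" "clique K E"
      by (auto simp: nsets_def)
    show "K \<in> [V - D]\<^bsup>Suc s\<^esup> \<union> (\<Union>v\<in>D. insert v ` [N v]\<^bsup>s\<^esup>)"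
    proof (cases "K \<inter> D = {}")
      case True
      then show ?thesis using K by (auto simp: nsets_def)
    next
      case False
      then obtain v where v: "v \<in> K" "v \<in> D" by blast
      then have "K - {v} \<in> [N v]\<^bsup>s\<^esup>"
        using K by (auto simp: nsets_def N_def clique_def)
      moreover have "K = insert v (K - {v})" using v by blast
      ultimately show ?thesis using v by blast
    qed
  qed
  then have "num_cliques (V, E) (Suc s)
      \<le> card ([V - D]\<^bsup>Suc s\<^esup> \<union> (\<Union>v\<in>D. insert v ` [N v]\<^bsup>s\<^esup>))"
    unfolding num_cliques_def using fin finD finN
    by (intro card_mono) (auto intro: finite_imp_finite_nsets)
  also have "\<dots> \<le> card ([V - D]\<^bsup>Suc s\<^esup>) + card (\<Union>v\<in>D. insert v ` [N v]\<^bsup>s\<^esup>)"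
    by (rule card_Un_le)
  also have "card ([V - D]\<^bsup>Suc s\<^esup>) = (card V - card D choose Suc s)"
    using \<open>D \<subseteq> V\<close> finD by (simp add: card_Diff_subset)
  also have "card (\<Union>v\<in>D. insert v ` [N v]\<^bsup>s\<^esup>) \<le> (\<Sum>v\<in>D. card (insert v ` [N v]\<^bsup>s\<^esup>))"
    by (rule card_UN_le[OF finD])
  also have "\<dots> \<le> (\<Sum>v\<in>D. k choose s)"
  proof (rule sum_mono)
    fix v assume "v \<in> D"
    have "card (insert v ` [N v]\<^bsup>s\<^esup>) \<le> card ([N v]\<^bsup>s\<^esup>)"
      by (intro card_image_le finite_imp_finite_nsets finN)
    also have "\<dots> \<le> (k choose s)"
      using deg[OF \<open>v \<in> D\<close>] degree_eq_card_neighbours[OF E, of v]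
      by (simp add: N_def binomial_right_mono)
    finally show "card (insert v ` [N v]\<^bsup>s\<^esup>) \<le> (k choose s)" .
  qed
  finally show ?thesis by simp
qed

section \<open>Convexity of the counting function\<close>

text \<open>Induction on the right end \<open>m\<close>; convexity is needed only to compare the old
  end with the new one.\<close>

lemma convex_seq_le_max:
  fixes f :: "nat \<Rightarrow> nat"
  assumes "d \<le> m"
    and conv: "\<And>k. d \<le> k \<Longrightarrow> Suc (Suc k) \<le> m \<Longrightarrow> 2 * f (Suc k) \<le> f k + f (Suc (Suc k))"
    and "d \<le> k" "k \<le> m"
  shows "f k \<le> max (f d) (f m)"
  using assms
proof (induction m arbitrary: k rule: dec_induct)
  case (step m)
  have IH: "f j \<le> max (f d) (f m)" if "d \<le> j" "j \<le> m" for j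
    using step.IH[of j] step.prems(1) that by simp
  \<comment> \<open>If \<open>f m\<close> exceeded both \<open>f d\<close> and
    \<open>f (Suc m)\<close>, the hypothesis would give \<open>f j \<le> f m\<close> for the
    predecessor \<open>j\<close> of \<open>m\<close>, contradicting convexity at
    \<open>m\<close>.\<close>
  have "f m \<le> max (f d) (f (Suc m))"
  proof (cases "m = d")
    case False
    then obtain j where j: "m = Suc j" "d \<le> j"
      using step.hyps(1) by (metis Suc_le_D le_antisym not_less_eq_eq)
    then show ?thesis
      using IH[of j] step.prems(1)[of j] by auto
  qed simp
  then show ?case
    using IH[of k] step.prems(2,3) by (cases "k = Suc m") auto
qed simp

text \<open>By Pascal's rule the successive differences are \<open>m choose (s - 1)\<close>, which
  grow with \<open>m\<close>.\<close>

lemma binomial_convex: "2 * (Suc m choose s) \<le> (m choose s) + (Suc (Suc m) choose s)"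
proof (cases s)
  case (Suc t)
  have "(m choose t) \<le> (Suc m choose t)" by (simp add: binomial_right_mono)
  then show ?thesis by (simp add: Suc)
qed simp

text \<open>The first summand is a binomial whose upper argument drops by one per step; the second
  is a linear factor times a convex nondecreasing sequence. The bounds on \<open>k\<close> keep the
  truncated subtractions exact.\<close>

lemma h_r_convex:
  assumes "l \<le> k" "Suc (Suc k) \<le> n"
  shows "2 * h_r r n (Suc k) l \<le> h_r r n k l + h_r r n (Suc (Suc k)) l"
proof -
  define m where "m = n - Suc (Suc k) + l"
  define a where "a = k - l"
  define c where "c j = (j choose (r - 1))" for j
  have m: "n - k + l = Suc (Suc m)" "n - Suc k + l = Suc m"
    using assms(2) by (auto simp: m_def)
  have a: "Suc k - l = Suc a" "Suc (Suc k) - l = Suc (Suc a)"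
    using assms(1) by (auto simp: a_def)
  have cc: "2 * c (Suc k) \<le> c k + c (Suc (Suc k))"
    unfolding c_def by (rule binomial_convex)
  have "c (Suc k) \<le> c (Suc (Suc k))" unfolding c_def by (simp add: binomial_right_mono)
  \<comment> \<open>The sum of \<open>a\<close> times the convexity of \<open>c\<close> and twice
    its monotonicity.\<close>
  then have "2 * (Suc a * c (Suc k)) \<le> a * c k + Suc (Suc a) * c (Suc (Suc k))"
    using mult_le_mono2[OF cc, of a] by (simp add: algebra_simps)
  from add_mono[OF binomial_convex[of m r] this] show ?thesis
    unfolding h_r_def m a m_def[symmetric] a_def[symmetric] c_def[symmetric]
    by (simp only: distrib_left add_ac)
qed

section \<open>The closure argument\<close>

text \<open>Listing the paths of \<open>F\<close> one after another and then the remaining vertices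
  gives such a cycle. It follows later that the saturated graph has a nonadjacent pair.\<close>

lemma linear_forest_in_hamiltonian_cycle_of_complete:
  assumes "finite V" "3 \<le> card V" "linear_forest F" "verts F \<subseteq> V"
  shows "\<exists>xs. hamiltonian_cycle (V, [V]\<^bsup>2\<^esup>) xs \<and> edges F \<subseteq> cycle_edges xs"
proof -
  obtain P where P: "finite P" "\<forall>xs\<in>P. xs \<noteq> [] \<and> distinct xs"
      "disjoint_family_on set P" "verts F = (\<Union>xs\<in>P. set xs)" "edges F = (\<Union>xs\<in>P. path_edges xs)"
    using assms(3) unfolding linear_forest_def by (elim exE conjE) (rule that)
  obtain xss where xss: "set xss = P" "distinct xss"
    using finite_distinct_list[OF P(1)] by blast
  obtain zs where zs: "set zs = V - verts F" "distinct zs"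
    using finite_distinct_list[of "V - verts F"] assms(1) by blast
  define xs where "xs = concat xss @ zs"
  have "distinct (concat xss)"
    using P(2,3) xss by (intro distinct_concat) (auto simp: disjoint_family_on_def)
  then have dist: "distinct xs"
    using zs P(4) xss(1) by (auto simp: xs_def)
  have set: "set xs = V"
    using zs(1) P(4) xss(1) assms(4) by (auto simp: xs_def)
  have len: "3 \<le> length xs"
    using distinct_card[OF dist] set assms(2) by simp
  have "edges F \<subseteq> path_edges (concat xss)"
    using path_edges_subset_concat xss(1) P(5) by blast
  then have "edges F \<subseteq> cycle_edges xs"
    using path_edges_subset_append(1)[of "concat xss" zs]
    by (auto simp: xs_def cycle_edges_def)
  moreover have "cycle_edges xs \<subseteq> [V]\<^bsup>2\<^esup>"
    using cycle_edges_nsets[OF dist] len set by simp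
  ultimately have "hamiltonian_cycle (V, [V]\<^bsup>2\<^esup>) xs \<and> edges F \<subseteq> cycle_edges xs"
    using dist set len by (simp add: hamiltonian_cycle_def)
  then show ?thesis by blast
qed

text \<open>Rotation makes \<open>e\<close> the closing edge, so that removing \<open>e\<close>
  leaves the hamiltonian path \<open>ys\<close>.\<close>

lemma hamiltonian_cycle_cut:
  assumes "hamiltonian_cycle G xs" "e \<in> cycle_edges xs"
  obtains ys where "hamiltonian_cycle G ys" "cycle_edges ys = cycle_edges xs" "e = {last ys, hd ys}"
proof (cases "e = {last xs, hd xs}")
  case True
  then show ?thesis using that assms(1) by blast
next
  case False
  then obtain i where i: "Suc i < length xs" "e = {xs ! i, xs ! Suc i}"
    using assms(2) by (auto simp: cycle_edges_def path_edges_def)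
  define ys where "ys = drop (Suc i) xs @ take (Suc i) xs"
  have cyc: "cycle_edges ys = cycle_edges xs"
    unfolding ys_def by (subst cycle_edges_append_commute) simp
  have "ys = rotate (Suc i) xs"
    using i(1) by (simp add: ys_def rotate_drop_take)
  then have "distinct ys = distinct xs" "set ys = set xs" "length ys = length xs"
    by simp_all
  moreover have "hd ys = xs ! Suc i" "last ys = xs ! i"
    using i(1) by (auto simp: ys_def hd_drop_conv_nth take_Suc_conv_app_nth)
  ultimately show ?thesis
    using that[of ys] assms(1) i(2) cyc by (auto simp: hamiltonian_cycle_def)
qed

lemma path_edges_split:
  assumes "Suc i < length xs"
  shows "path_edges xs = insert {xs ! i, xs ! Suc i}
    (path_edges (take (Suc i) xs) \<union> path_edges (drop (Suc i) xs))"
proof -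
  have "last (take (Suc i) xs) = xs ! i" "hd (drop (Suc i) xs) = xs ! Suc i"
    using assms by (auto simp: hd_drop_conv_nth take_Suc_conv_app_nth)
  moreover have "take (Suc i) xs \<noteq> []" "drop (Suc i) xs \<noteq> []"
    using assms by auto
  ultimately show ?thesis
    using path_edges_append[of "take (Suc i) xs" "drop (Suc i) xs"] by simp
qed

text \<open>If the ends of a hamiltonian path are joined crosswise to two consecutive vertices of the
  path, then deleting the edge between these two gives a hamiltonian cycle; it still contains the
  edge set \<open>F\<close> unless the deleted edge lies in \<open>F\<close>.\<close>

lemma degree_sum_le_if_not_hamiltonian:
  assumes fin: "finite V" and E: "E \<subseteq> [V]\<^bsup>2\<^esup>" and F: "F \<subseteq> E" and uv: "{u, v} \<notin> E"
    and ham: "hamiltonian_cycle (V, insert {u, v} E) xs" "F \<subseteq> cycle_edges xs"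
    and nham: "\<nexists>xs. hamiltonian_cycle (V, E) xs \<and> F \<subseteq> cycle_edges xs"
  shows "degree (V, E) u + degree (V, E) v \<le> card V - 1 + card F"
proof -
  have finF: "finite F"
    using F E fin by (meson finite_imp_finite_nsets finite_subset)
  \<comment> \<open>A cycle avoiding the new edge would already lie in \<open>E\<close>.\<close>
  have "{u, v} \<in> cycle_edges xs"
    using ham nham by (auto simp: hamiltonian_cycle_def)
  then obtain ys where ys: "hamiltonian_cycle (V, insert {u, v} E) ys"
      "cycle_edges ys = cycle_edges xs" "{u, v} = {last ys, hd ys}"
    using hamiltonian_cycle_cut[OF ham(1)] by metis
  have dist: "distinct ys" and set: "set ys = V" and len: "3 \<le> length ys"
    using ys(1) by (auto simp: hamiltonian_cycle_def)
  have cardV: "card V = length ys" using distinct_card[OF dist] set by simp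
  define a where "a = hd ys"
  define b where "b = last ys"
  have ab: "{u, v} = {b, a}" using ys(3) by (simp add: a_def b_def)
  have pE: "path_edges ys - {{a, b}} \<subseteq> E"
    using ys(1) ab by (auto simp: hamiltonian_cycle_def cycle_edges_def insert_commute)
  have ab_nE: "{a, b} \<notin> E" using uv ab by (simp add: insert_commute)
  have FP: "F \<subseteq> path_edges ys"
  proof -
    have "F \<subseteq> insert {b, a} (path_edges ys)"
      using ham(2) unfolding ys(2)[symmetric] by (simp add: cycle_edges_def a_def b_def)
    then show ?thesis using F ab_nE by (auto simp: insert_commute)
  qed
  define m where "m = length ys - 1"
  \<comment> \<open>Index \<open>i\<close> stands for the path edge from \<open>ys ! i\<close> to
    \<open>ys ! Suc i\<close>. Neighbours of \<open>a\<close> are recorded by their predecessors,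
    neighbours of \<open>b\<close> by their own positions, so both sets lie in
    \<open>{..<m}\<close>.\<close>
  define S where "S = {i. i < m \<and> {a, ys ! Suc i} \<in> E}"
  define T where "T = {i. i < m \<and> {b, ys ! i} \<in> E}"
  have "ys \<noteq> []" using len by auto
  then have a: "a = ys ! 0" and b: "b = ys ! m"
    by (simp_all add: a_def b_def m_def hd_conv_nth last_conv_nth)
  have irrefl: "{x, x} \<notin> E" for x using E by (auto simp: nsets_def)
  have nbV: "\<exists>i. i \<le> m \<and> w = ys ! i" if "{x, w} \<in> E" for x w
  proof -
    have "w \<in> set ys" using E that by (auto simp: nsets_def set)
    then obtain i where "i < length ys" "w = ys ! i" by (auto simp: in_set_conv_nth)
    then show ?thesis by (intro exI[of _ i]) (simp add: m_def)
  qed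
  have "{w. {a, w} \<in> E} = (\<lambda>i. ys ! Suc i) ` S"
  proof (intro subset_antisym subsetI)
    fix w assume w: "w \<in> {w. {a, w} \<in> E}"
    then obtain i where i: "i \<le> m" "w = ys ! i" using nbV by blast
    with w irrefl a obtain j where "i = Suc j" by (cases i) auto
    with i w show "w \<in> (\<lambda>i. ys ! Suc i) ` S" by (auto simp: S_def)
  qed (auto simp: S_def)
  moreover have "inj_on (\<lambda>i. ys ! Suc i) S"
    using dist by (auto simp: inj_on_def S_def m_def nth_eq_iff_index_eq)
  ultimately have dega: "degree (V, E) a = card S"
    by (simp add: degree_eq_card_neighbours[OF E] card_image)
  have "{w. {b, w} \<in> E} = (\<lambda>i. ys ! i) ` T"
  proof (intro subset_antisym subsetI)
    fix w assume w: "w \<in> {w. {b, w} \<in> E}"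
    then obtain i where i: "i \<le> m" "w = ys ! i" using nbV by blast
    with w irrefl b have "i \<noteq> m" by auto
    with i w show "w \<in> (\<lambda>i. ys ! i) ` T" by (auto simp: T_def)
  qed (auto simp: T_def)
  moreover have "inj_on (\<lambda>i. ys ! i) T"
    using dist by (auto simp: inj_on_def T_def m_def nth_eq_iff_index_eq)
  ultimately have degb: "degree (V, E) b = card T"
    by (simp add: degree_eq_card_neighbours[OF E] card_image)
  \<comment> \<open>Otherwise run along \<open>p\<close> from \<open>a\<close> to
    \<open>ys ! i\<close>, jump to \<open>b\<close>, return along \<open>q\<close> to
    \<open>ys ! Suc i\<close> and close up at \<open>a\<close>.\<close>
  have cross: "{ys ! i, ys ! Suc i} \<in> F" if "i \<in> S \<inter> T" for i
  proof (rule ccontr)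
    assume nF: "{ys ! i, ys ! Suc i} \<notin> F"
    have i: "Suc i < length ys" "{a, ys ! Suc i} \<in> E" "{b, ys ! i} \<in> E"
      using that by (auto simp: S_def T_def m_def)
    define p where "p = take (Suc i) ys"
    define q where "q = drop (Suc i) ys"
    have pq: "ys = p @ q" "p \<noteq> []" "q \<noteq> []" using i(1) by (auto simp: p_def q_def)
    have ends: "last p = ys ! i" "hd q = ys ! Suc i"
      using i(1) by (simp_all add: p_def q_def hd_drop_conv_nth take_Suc_conv_app_nth)
    have "hd p = a" "last q = b"
      using pq by (simp_all add: a_def b_def)
    note ends = ends this
    define zs where "zs = p @ rev q"
    have cyc: "cycle_edges zs =
        insert {ys ! Suc i, a} (insert {ys ! i, b} (path_edges p \<union> path_edges q))"
      using pq ends by (simp add: zs_def cycle_edges_def path_edges_append hd_rev last_rev)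
    have split: "path_edges ys = insert {ys ! i, ys ! Suc i} (path_edges p \<union> path_edges q)"
      using path_edges_split[OF i(1)] by (simp add: p_def q_def)
    \<comment> \<open>The one edge of \<open>ys\<close> that may be missing from \<open>E\<close> is
      \<open>{a, b}\<close>, and its ends lie in different pieces.\<close>
    have "{a, b} \<notin> path_edges p \<union> path_edges q"
    proof -
      have "set p \<inter> set q = {}" using dist pq(1) by (metis distinct_append)
      moreover have "a \<in> set p" "b \<in> set q" using pq ends by (metis hd_in_set, metis last_in_set)
      moreover have "e \<subseteq> set p" if "e \<in> path_edges p" for e
        using path_edges_nsets[of p] dist pq(1) that by (auto simp: nsets_def)
      moreover have "e \<subseteq> set q" if "e \<in> path_edges q" for e
        using path_edges_nsets[of q] dist pq(1) that by (auto simp: nsets_def)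
      ultimately show ?thesis by blast
    qed
    then have "path_edges p \<union> path_edges q \<subseteq> E" using pE split by blast
    then have "cycle_edges zs \<subseteq> E"
      using i by (simp add: cyc insert_commute)
    moreover have "distinct zs" "set zs = V" "length zs = length ys"
      using dist set by (auto simp: zs_def pq(1))
    ultimately have "hamiltonian_cycle (V, E) zs"
      using len by (simp add: hamiltonian_cycle_def)
    moreover have "F \<subseteq> cycle_edges zs" using FP split nF cyc by auto
    ultimately show False using nham by blast
  qed
  have finST: "finite S" "finite T" by (simp_all add: S_def T_def)
  \<comment> \<open>Crossing positions inject into \<open>F\<close>, so the degree sum,
    \<open>card (S \<union> T) + card (S \<inter> T)\<close>, is at most
    \<open>m + card F\<close>.\<close>
  have "card (S \<inter> T) \<le> card F"
  proof (rule card_inj_on_le[OF _ _ finF])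
    show "inj_on (\<lambda>i. {ys ! i, ys ! Suc i}) (S \<inter> T)"
      using dist by (auto simp: inj_on_def S_def m_def doubleton_eq_iff nth_eq_iff_index_eq)
    show "(\<lambda>i. {ys ! i, ys ! Suc i}) ` (S \<inter> T) \<subseteq> F" using cross by blast
  qed
  moreover have "card (S \<union> T) \<le> m"
    using card_mono[of "{..<m}" "S \<union> T"] by (auto simp: S_def T_def)
  moreover have "card S + card T = card (S \<union> T) + card (S \<inter> T)"
    by (rule card_Un_Int[OF finST])
  moreover have "degree (V, E) u + degree (V, E) v = degree (V, E) a + degree (V, E) b"
    using ab by (auto simp: doubleton_eq_iff)
  ultimately show ?thesis by (simp add: dega degb cardV m_def)
qed

lemma low_degree_set_if_not_l_hamiltonian:
  assumes G: "simple_graph G" "card (verts G) = n" "\<not> l_hamiltonian l G"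
    and "3 \<le> n" and deg: "\<And>v. v \<in> verts G \<Longrightarrow> d \<le> degree G v"
  obtains E D k where "edges G \<subseteq> E" "E \<subseteq> [verts G]\<^bsup>2\<^esup>" "d \<le> k" "2 * k < n + l" "D \<subseteq> verts G"
    "card D = k - l" "\<And>v. v \<in> D \<Longrightarrow> degree (verts G, E) v \<le> k"
proof -
  define V where "V = verts G"
  have fin: "finite V" and EG: "edges G \<subseteq> [V]\<^bsup>2\<^esup>" and cardV: "card V = n"
    using G by (auto simp: simple_graph_def V_def)
  have finV2: "finite ([V]\<^bsup>2\<^esup>)" using fin by (rule finite_imp_finite_nsets)
  obtain F where F: "linear_forest F" "verts F \<subseteq> V" "edges F \<subseteq> edges G" "card (edges F) = l"
      "\<nexists>xs. hamiltonian_cycle G xs \<and> edges F \<subseteq> cycle_edges xs"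
    using G(3) unfolding l_hamiltonian_def subgraph_def V_def by blast
  \<comment> \<open>The forest \<open>F\<close> stays fixed while edges are added; a maximal member
    of \<open>C\<close> is the saturated graph.\<close>
  define C where "C = {E. edges G \<subseteq> E \<and> E \<subseteq> [V]\<^bsup>2\<^esup> \<and>
    (\<nexists>xs. hamiltonian_cycle (V, E) xs \<and> edges F \<subseteq> cycle_edges xs)}"
  have "C \<subseteq> Pow ([V]\<^bsup>2\<^esup>)" by (auto simp: C_def)
  then have "finite C" using finV2 finite_subset by blast
  moreover have "edges G \<in> C" using EG F(5) by (simp add: C_def V_def)
  ultimately obtain E where E: "E \<in> C" and maxE: "\<And>E'. E' \<in> C \<Longrightarrow> E \<subseteq> E' \<Longrightarrow> E = E'"
    using finite_has_maximal[of C] by blast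
  have GE: "edges G \<subseteq> E" and EV: "E \<subseteq> [V]\<^bsup>2\<^esup>"
    and nham: "\<nexists>xs. hamiltonian_cycle (V, E) xs \<and> edges F \<subseteq> cycle_edges xs"
    using E by (auto simp: C_def)
  define dg where "dg = degree (V, E)"
  \<comment> \<open>By maximality, adding a missing edge creates a hamiltonian cycle through
    \<open>F\<close>.\<close>
  have Ore: "dg u + dg v \<le> n - 1 + l" if "u \<in> V" "v \<in> V" "u \<noteq> v" "{u, v} \<notin> E" for u v
  proof -
    have "insert {u, v} E \<notin> C" using maxE[of "insert {u, v} E"] that(4) by blast
    moreover have "{u, v} \<in> [V]\<^bsup>2\<^esup>" using that by (simp add: nsets_def)
    ultimately obtain xs where "hamiltonian_cycle (V, insert {u, v} E) xs" "edges F \<subseteq> cycle_edges xs"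
      using GE EV by (auto simp: C_def)
    then show ?thesis
      using degree_sum_le_if_not_hamiltonian[OF fin EV _ that(4) _ _ nham] F(3,4) GE cardV
      by (simp add: dg_def)
  qed
  define Q where "Q = {(u, v). u \<in> V \<and> v \<in> V \<and> u \<noteq> v \<and> {u, v} \<notin> E}"
  define f where "f = (\<lambda>(u, v). dg u + dg v)"
  have "Q \<subseteq> V \<times> V" by (auto simp: Q_def)
  then have finQ: "finite Q" using fin by (meson finite_SigmaI finite_subset)
  have "E \<noteq> [V]\<^bsup>2\<^esup>"
    using linear_forest_in_hamiltonian_cycle_of_complete[OF fin _ F(1,2)] nham assms(4) cardV
    by blast
  then obtain e where e: "e \<in> [V]\<^bsup>2\<^esup>" "e \<notin> E" using EV by blast
  then obtain x y where "e = {x, y}" "x \<noteq> y" by (auto simp: nsets_def card_2_iff)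
  then have "(x, y) \<in> Q" using e by (auto simp: Q_def nsets_def)
  then have "Max (f ` Q) \<in> f ` Q" using finQ by (intro Max_in) auto
  then obtain p where p: "p \<in> Q" "f p = Max (f ` Q)" by auto
  have maxp: "f q \<le> f p" if "q \<in> Q" for q
    using that finQ p(2) by simp
  \<comment> \<open>Both \<open>Q\<close> and \<open>f\<close> are symmetric, so the vertex of
    smaller degree can be put first.\<close>
  have "\<exists>u v. (u, v) \<in> Q \<and> f (u, v) = f p \<and> dg u \<le> dg v"
  proof -
    obtain u v where uv: "p = (u, v)" by force
    then have "(v, u) \<in> Q" using p(1) by (auto simp: Q_def insert_commute)
    moreover have "f (v, u) = f p" using uv by (simp add: f_def)
    ultimately show ?thesis using p(1) uv by (meson nle_le)
  qed
  then obtain u v where uv: "(u, v) \<in> Q" "f (u, v) = f p" "dg u \<le> dg v" by blast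
  then have uvV: "u \<in> V" "v \<in> V" "u \<noteq> v" "{u, v} \<notin> E" by (auto simp: Q_def)
  define N where "N = {w. {v, w} \<in> E}"
  define D0 where "D0 = V - insert v N"
  have N: "N \<subseteq> V" "v \<notin> N" using EV by (auto simp: N_def nsets_def)
  then have "card (insert v N) = Suc (dg v)"
    using fin finite_subset[of N V]
    by (simp add: dg_def degree_eq_card_neighbours[OF EV] N_def)
  moreover have "insert v N \<subseteq> V" "finite (insert v N)"
    using N uvV(2) fin finite_subset[of N V] by auto
  ultimately have "card D0 = n - Suc (dg v)" by (simp add: D0_def card_Diff_subset cardV)
  \<comment> \<open>\<open>D0\<close> has \<open>n - 1 - dg v\<close> elements, and the Ore bound
    says that this is at least \<open>dg u - l\<close>.\<close>
  then have "dg u - l \<le> card D0" using Ore[OF uvV] by simp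
  then obtain D where D: "D \<subseteq> D0" "card D = dg u - l"
    by (meson obtain_subset_with_card_n)
  show thesis
  proof (rule that[of E "dg u" D])
    have "d \<le> degree G u" using deg uvV(1) by (simp add: V_def)
    also have "\<dots> \<le> dg u"
      unfolding dg_def degree_def using GE finite_subset[OF EV finV2]
      by (intro card_mono) auto
    finally show "d \<le> dg u" .
    show "2 * dg u < n + l" using Ore[OF uvV] uv(3) \<open>3 \<le> n\<close> by simp
    fix w assume "w \<in> D"
    then have "(w, v) \<in> Q" using D(1) uvV(2) by (auto simp: D0_def N_def Q_def insert_commute)
    \<comment> \<open>The pair \<open>(w, v)\<close> competes with the maximal pair
      \<open>(u, v)\<close>.\<close>
    then have "dg w + dg v \<le> dg u + dg v" using maxp[of "(w, v)"] uv(2) by (simp add: f_def)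
    then show "degree (verts G, E) w \<le> dg u" by (simp add: dg_def V_def)
  qed (use GE EV D in \<open>auto simp: V_def D0_def\<close>)
qed

text \<open>With \<open>k - l\<close> vertices of degree at most \<open>k\<close>, the clique count
  is bounded by exactly \<open>h_r r n k l\<close>; convexity in \<open>k\<close> then moves to an
  end of the range.\<close>

lemma num_cliques_le_if_not_l_hamiltonian:
  assumes G: "simple_graph G" "card (verts G) = n" "\<not> l_hamiltonian l G" "d \<le> min_degree G"
    and "0 < r" "l < d" "d \<le> (n + l - 1) div 2"
  shows "num_cliques G r \<le> max (h_r r n d l) (h_r r n ((n + l - 1) div 2) l)"
proof -
  \<comment> \<open>The parameter range even forces \<open>n \<ge> l + 3\<close>.\<close>
  have n: "3 \<le> n" using assms(6,7) by linarith
  have fin: "finite (verts G)" using G(1) by (simp add: simple_graph_def)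
  have "d \<le> degree G v" if "v \<in> verts G" for v
    using G(4) fin that by (auto simp: min_degree_def intro: order_trans Min_le)
  then obtain E D k where E: "edges G \<subseteq> E" "E \<subseteq> [verts G]\<^bsup>2\<^esup>" and k: "d \<le> k" "2 * k < n + l"
      and D: "D \<subseteq> verts G" "card D = k - l" "\<And>v. v \<in> D \<Longrightarrow> degree (verts G, E) v \<le> k"
    using low_degree_set_if_not_l_hamiltonian[OF G(1-3) n] by metis
  obtain s where s: "r = Suc s" using \<open>0 < r\<close> by (cases r) auto
  have "num_cliques G r \<le> num_cliques (verts G, E) r"
    using num_cliques_mono[OF fin E(1), of r] by simp
  also have "\<dots> \<le> (card (verts G) - card D choose Suc s) + card D * (k choose s)"
    unfolding s by (rule num_cliques_le_low_degree[OF fin E(2) D(1,3)])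
  also have "\<dots> = h_r r n k l"
    using k \<open>l < d\<close> by (simp add: h_r_def s D(2) G(2))
  also have "\<dots> \<le> max (h_r r n d l) (h_r r n ((n + l - 1) div 2) l)"
  proof (rule convex_seq_le_max[where f = "\<lambda>k. h_r r n k l"])
    fix j assume "d \<le> j" "Suc (Suc j) \<le> (n + l - 1) div 2"
    then show "2 * h_r r n (Suc j) l \<le> h_r r n j l + h_r r n (Suc (Suc j)) l"
      using \<open>l < d\<close> by (intro h_r_convex) linarith+
  qed (use k assms(7) in linarith)+
  finally show ?thesis .
qed

section \<open>The extremal graphs\<close>

text \<open>The condition \<open>2 * d < n + l\<close> is the upper bound on \<open>d\<close>
  without division. Both extremal graphs are instances.\<close>

locale H_parameters =
  fixes n d l :: nat
  assumes l_less: "l < d" and d_less: "2 * d < n + l"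
begin

text \<open>Vertices below \<open>m\<close> form the clique \<open>A\<close>, those from
  \<open>m\<close> on are the new ones; \<open>B\<close> is \<open>{..<d}\<close>.\<close>

definition m :: nat where "m = n - d + l"

lemma m_bounds: "d < m" "m < n" "n - m = d - l"
  using l_less d_less by (auto simp: m_def)

lemma verts_H [simp]: "verts (H_graph n d l) = {..<n}"
  by (simp add: H_graph_def)

lemma edges_H: "edges (H_graph n d l) = [{..<m}]\<^bsup>2\<^esup> \<union> {{s, b} | s b. s \<in> {m..<n} \<and> b \<in> {..<d}}"
  by (simp add: H_graph_def m_def)

lemma edge_H_iff:
  "{x, y} \<in> edges (H_graph n d l) \<longleftrightarrow> x \<noteq> y \<and>
    (x < m \<and> y < m \<or> m \<le> x \<and> x < n \<and> y < d \<or> m \<le> y \<and> y < n \<and> x < d)"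
  using m_bounds by (auto simp: edges_H nsets_def doubleton_eq_iff)

lemma edges_H_nsets: "edges (H_graph n d l) \<subseteq> [{..<n}]\<^bsup>2\<^esup>"
  using m_bounds by (auto simp: edges_H nsets_def card_2_iff')

lemma simple_graph_H: "simple_graph (H_graph n d l)"
  using edges_H_nsets by (simp add: simple_graph_def)

text \<open>A vertex of \<open>A\<close> has at least \<open>m - 1\<close> neighbours and
  \<open>d < m\<close>; a new vertex is joined to all of \<open>B\<close>.\<close>

lemma min_degree_H: "d \<le> min_degree (H_graph n d l)"
proof -
  have "d \<le> degree (H_graph n d l) v" if "v < n" for v
  proof -
    have *: "degree (H_graph n d l) v = card {w. {v, w} \<in> edges (H_graph n d l)}" (is "_ = card ?N")
      using degree_eq_card_neighbours[OF edges_H_nsets] by (metis prod.collapse verts_H)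
    have fin: "finite ?N"
      by (rule finite_subset[of _ "{..<n}"]) (use m_bounds in \<open>auto simp: edge_H_iff\<close>)
    show ?thesis
    proof (cases "v < m")
      case True
      then have "card ({..<m} - {v}) \<le> card ?N"
        by (intro card_mono fin) (auto simp: edge_H_iff)
      then show ?thesis using True m_bounds(1) by (simp add: *)
    next
      case False
      then have "card {..<d} \<le> card ?N"
        using that m_bounds by (intro card_mono fin) (auto simp: edge_H_iff)
      then show ?thesis by (simp add: *)
    qed
  qed
  then show ?thesis using m_bounds by (simp add: min_degree_def lessThan_empty_iff)
qed

text \<open>New vertices have neighbours only in \<open>B\<close>, so a clique lies inside
  \<open>A\<close> or consists of one new vertex and \<open>r - 1\<close> vertices of
  \<open>B\<close>.\<close>

lemma num_cliques_H:
  assumes "2 \<le> r"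
  shows "num_cliques (H_graph n d l) r = h_r r n d l"
proof -
  define s where "s = r - 1"
  have r: "r = Suc s" "0 < s" using assms by (auto simp: s_def)
  define U where "U v = insert v ` [{..<d}]\<^bsup>s\<^esup>" for v :: nat
  have "{K \<in> [{..<n}]\<^bsup>r\<^esup>. clique K (edges (H_graph n d l))} = [{..<m}]\<^bsup>r\<^esup> \<union> (\<Union>v\<in>{m..<n}. U v)"
    (is "?L = ?R")
  proof (intro subset_antisym subsetI)
    fix K assume K: "K \<in> ?L"
    then have K': "K \<subseteq> {..<n}" "finite K" "card K = r" "clique K (edges (H_graph n d l))"
      by (auto simp: nsets_def)
    show "K \<in> ?R"
    proof (cases "K \<subseteq> {..<m}")
      case True
      then show ?thesis using K' by (auto simp: nsets_def)
    next
      case False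
      then obtain v where v: "v \<in> K" "m \<le> v" "v < n" using K'(1) by (auto simp: subset_iff not_less)
      have "K - {v} \<subseteq> {..<d}"
      proof
        fix w assume "w \<in> K - {v}"
        then have "{v, w} \<in> edges (H_graph n d l)"
          using K'(4) v(1) by (auto simp: clique_def)
        then show "w \<in> {..<d}" using v m_bounds by (auto simp: edge_H_iff)
      qed
      then have "K - {v} \<in> [{..<d}]\<^bsup>s\<^esup>" using K' v(1) r by (auto simp: nsets_def)
      moreover have "K = insert v (K - {v})" using v(1) by blast
      ultimately have "K \<in> U v" unfolding U_def by blast
      then show ?thesis using v by auto
    qed
  next
    fix K assume "K \<in> ?R"
    then consider "K \<in> [{..<m}]\<^bsup>r\<^esup>"
      | v B where "v \<in> {m..<n}" "B \<in> [{..<d}]\<^bsup>s\<^esup>" "K = insert v B"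
      by (auto simp: U_def)
    then show "K \<in> ?L"
    proof cases
      case 1
      then show ?thesis using m_bounds by (auto simp: nsets_def clique_def edge_H_iff)
    next
      case 2
      then have "v \<notin> B" using m_bounds by (auto simp: nsets_def)
      then show ?thesis
        using 2 m_bounds r by (auto simp: nsets_def clique_def edge_H_iff)
    qed
  qed
  moreover have "card ([{..<m}]\<^bsup>r\<^esup> \<union> (\<Union>v\<in>{m..<n}. U v)) = (m choose r) + (d - l) * (d choose s)"
  proof -
    have Ud: "v \<in> K \<and> K \<subseteq> insert v {..<d}" if "K \<in> U v" for K v
      using that by (auto simp: U_def nsets_def)
    have finU: "finite (U v)" for v by (simp add: U_def finite_imp_finite_nsets)
    have cardU: "card (U v) = (d choose s)" if "v \<in> {m..<n}" for v
    proof -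
      have "inj_on (insert v) ([{..<d}]\<^bsup>s\<^esup>)"
      proof (rule inj_onI)
        fix A B assume AB: "A \<in> [{..<d}]\<^bsup>s\<^esup>" "B \<in> [{..<d}]\<^bsup>s\<^esup>" "insert v A = insert v B"
        have "v \<notin> A" "v \<notin> B"
          using AB(1,2) that m_bounds by (auto simp: nsets_def)
        then show "A = B" using AB(3) by (metis insert_ident)
      qed
      then show ?thesis by (simp add: U_def card_image)
    qed
    have "U v \<inter> U w = {}" if vw: "v \<in> {m..<n}" "w \<in> {m..<n}" "v \<noteq> w" for v w
    proof (rule equals0I)
      fix K assume "K \<in> U v \<inter> U w"
      then have "v \<in> K" "K \<subseteq> insert w {..<d}" using Ud[of K v] Ud[of K w] by auto
      then show False using vw m_bounds by auto
    qed
    then have "card (\<Union>v\<in>{m..<n}. U v) = (\<Sum>v\<in>{m..<n}. card (U v))"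
      using finU by (intro card_UN_disjoint) auto
    also have "\<dots> = (d - l) * (d choose s)" using cardU m_bounds(3) by simp
    finally have *: "card (\<Union>v\<in>{m..<n}. U v) = (d - l) * (d choose s)" .
    have "[{..<m}]\<^bsup>r\<^esup> \<inter> U v = {}" if "v \<in> {m..<n}" for v
      using that by (auto simp: U_def nsets_def)
    then have "[{..<m}]\<^bsup>r\<^esup> \<inter> (\<Union>v\<in>{m..<n}. U v) = {}" by blast
    then show ?thesis
      using * finU by (subst card_Un_disjoint) (auto intro: finite_imp_finite_nsets)
  qed
  ultimately show ?thesis by (simp add: num_cliques_def h_r_def s_def m_def)
qed

text \<open>The forest is a path with \<open>l\<close> edges inside \<open>B\<close>. On a hamiltonian cycle containing it, the
  \<open>2 (d - l)\<close> edge ends at the new vertices and the \<open>2 l\<close> edge ends of the path use up all \<open>2 d\<close> edge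
  ends at \<open>B\<close>, so the cycle cannot leave the union of \<open>B\<close> and the new vertices.\<close>

lemma not_l_hamiltonian_H: "\<not> l_hamiltonian l (H_graph n d l)"
proof
  assume ham: "l_hamiltonian l (H_graph n d l)"
  \<comment> \<open>The path has \<open>Suc l\<close> vertices and fits into \<open>B\<close>
    because \<open>l < d\<close>; for \<open>l = 0\<close> it is a single vertex.\<close>
  define F where "F = path_edges [0..<Suc l]"
  have F_eq: "F = (\<lambda>i. {i, Suc i}) ` {..<l}"
  proof -
    have "F = {{i, Suc i} | i. i < l}"
      unfolding F_def path_edges_def
      by (intro Collect_cong ex_cong1 rev_conj_cong) (simp_all del: upt_Suc)
    then show ?thesis by auto
  qed
  have "inj_on (\<lambda>i. {i, Suc i}) {..<l}" by (auto simp: inj_on_def doubleton_eq_iff)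
  then have cardF: "card F = l" by (simp add: F_eq card_image)
  have FB: "e \<subseteq> {..<d} \<and> card e = 2" if "e \<in> F" for e
    using that l_less by (auto simp: F_eq)
  have FE: "F \<subseteq> edges (H_graph n d l)"
    using l_less m_bounds by (auto simp: F_eq edge_H_iff)
  have "linear_forest ({..<Suc l}, F)"
    unfolding linear_forest_def
    by (rule exI[of _ "{[0..<Suc l]}"])
      (auto simp: F_def disjoint_family_on_def simp del: upt_Suc)
  moreover have "subgraph ({..<Suc l}, F) (H_graph n d l)"
    using FE l_less m_bounds by (auto simp: subgraph_def)
  ultimately obtain xs where xs: "hamiltonian_cycle (H_graph n d l) xs" "F \<subseteq> cycle_edges xs"
    using ham cardF unfolding l_hamiltonian_def by (metis snd_conv)
  then have dist: "distinct xs" and set: "set xs = {..<n}" and len: "3 \<le> length xs"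
    and CE: "cycle_edges xs \<subseteq> edges (H_graph n d l)"
    by (auto simp: hamiltonian_cycle_def)
  define C where "C = cycle_edges xs"
  have finC: "finite C"
    using CE edges_H_nsets unfolding C_def
    by (meson finite_imp_finite_nsets finite_lessThan finite_subset)
  define S where "S = {m..<n}"
  define B where "B = {..<d}"
  \<comment> \<open>Double counting of pairs of a vertex in \<open>X\<close> and a cycle edge
    through it.\<close>
  have incidences: "(\<Sum>e\<in>C. card (e \<inter> X)) = 2 * card X" if "X \<subseteq> {..<n}" for X
  proof -
    have "(\<Sum>e\<in>C. card {x \<in> X. x \<in> e}) = 2 * card X"
    proof (rule sum_multicount[OF finC])
      show "finite X" using that finite_subset by blast
      show "\<forall>x\<in>X. card {e \<in> C. x \<in> e} = 2"
        using card_cycle_edges_at[OF dist len] that set by (auto simp: C_def)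
    qed
    moreover have "{x \<in> X. x \<in> e} = e \<inter> X" for e by blast
    ultimately show ?thesis by simp
  qed
  define g where "g e = card (e \<inter> S) + (if e \<in> F then 2 else 0)" for e
  \<comment> \<open>A forest edge has both ends in \<open>B\<close>; any other edge meeting
    \<open>S\<close> has one end in \<open>S\<close> and one in \<open>B\<close>.\<close>
  have le: "g e \<le> card (e \<inter> B)" if "e \<in> C" for e
  proof (cases "e \<in> F")
    case True
    then have "e \<inter> B = e" "e \<inter> S = {}" using FB[of e] m_bounds by (auto simp: B_def S_def)
    then show ?thesis using FB[of e] True by (simp add: g_def)
  next
    case False
    have "e \<in> edges (H_graph n d l)" using that CE by (auto simp: C_def)
    then consider "e \<inter> S = {}" | s b where "s \<in> S" "b \<in> B" "e = {s, b}"
      unfolding edges_H S_def B_def by (fastforce simp: nsets_def)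
    then show ?thesis
    proof cases
      case 2
      then have "e \<inter> S = {s}" "e \<inter> B = {b}" using m_bounds by (auto simp: S_def B_def)
      then show ?thesis using False by (simp add: g_def)
    qed (use False in \<open>simp add: g_def\<close>)
  qed
  have "sum g C = 2 * (d - l) + 2 * l"
  proof -
    have "sum g C = (\<Sum>e\<in>C. card (e \<inter> S)) + (\<Sum>e\<in>C. if e \<in> F then 2 else 0)"
      by (simp add: g_def sum.distrib)
    also have "(\<Sum>e\<in>C. if e \<in> F then 2 else 0) = 2 * card (C \<inter> F)"
      using finC by (simp add: sum.If_cases)
    also have "C \<inter> F = F" using xs(2) by (auto simp: C_def)
    also have "(\<Sum>e\<in>C. card (e \<inter> S)) = 2 * (d - l)"
      using incidences[of S] m_bounds by (simp add: S_def subset_iff)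
    finally show ?thesis by (simp only: cardF)
  qed
  also have "\<dots> = (\<Sum>e\<in>C. card (e \<inter> B))"
    using incidences[of B] l_less m_bounds by (auto simp: B_def)
  finally have sum_eq: "sum g C = (\<Sum>e\<in>C. card (e \<inter> B))" .
  \<comment> \<open>Termwise inequality with equal sums forces equality for every edge.\<close>
  have eq: "g e = card (e \<inter> B)" if "e \<in> C" for e
    using sum_mono_inv[OF sum_eq le that finC] .
  have "set xs \<subseteq> B \<union> S"
  proof (rule cycle_closed_set)
    show "(B \<union> S) \<inter> set xs \<noteq> {}" using m_bounds by (auto simp: set S_def)
    fix e assume e: "e \<in> cycle_edges xs" "e \<inter> (B \<union> S) \<noteq> {}"
    have e2: "finite e" "card e = 2"
      using e(1) CE edges_H_nsets by (auto simp: nsets_def)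
    show "e \<subseteq> B \<union> S"
    proof (cases "e \<in> F")
      case False
      have BS: "B \<inter> S = {}" using m_bounds by (auto simp: B_def S_def)
      \<comment> \<open>Outside the forest, an edge has as many ends in \<open>S\<close> as in
        \<open>B\<close>; if it meets \<open>B \<union> S\<close>, it therefore has one end in
        each.\<close>
      have same: "card (e \<inter> S) = card (e \<inter> B)" using eq[of e] e(1) False by (simp add: g_def C_def)
      then have "card (e \<inter> B) \<noteq> 0"
        using e(2) e2(1) by auto
      moreover have "card (e \<inter> (B \<union> S)) = card (e \<inter> B) + card (e \<inter> S)"
        using e2(1) BS by (simp add: Int_Un_distrib) (subst card_Un_disjoint; auto)
      ultimately have "card e \<le> card (e \<inter> (B \<union> S))" using same e2(2) by simp
      then show ?thesis using e2(1) by (metis card_seteq inf_le1 inf.orderI)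
    qed (use FB in \<open>auto simp: B_def\<close>)
  qed
  \<comment> \<open>Since \<open>d < m\<close>, the vertex \<open>d\<close> lies in \<open>A\<close>
    but not in \<open>B\<close>.\<close>
  moreover have "d \<in> set xs" "d \<notin> B \<union> S" using m_bounds by (auto simp: set B_def S_def)
  ultimately show False by blast
qed

end

theorem theorem4:
  fixes n d r l :: nat
  assumes "r \<ge> 2" and "l < d" and "d \<le> (n + l - 1) div 2"
  shows
    "(\<forall>G :: 'a ugraph.
        simple_graph G \<and> card (verts G) = n \<and> min_degree G \<ge> d \<and> \<not> l_hamiltonian l G \<longrightarrow>
          num_cliques G r \<le> max (h_r r n d l) (h_r r n ((n + l - 1) div 2) l) \<and>
          card (edges G) \<le> max (h n d l) (h n ((n + l - 1) div 2) l)) \<and>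
     (\<forall>H \<in> {H_graph n d l, H_graph n ((n + l - 1) div 2) l}.
        simple_graph H \<and> card (verts H) = n \<and> min_degree H \<ge> d \<and> \<not> l_hamiltonian l H) \<and>
     (\<exists>H \<in> {H_graph n d l, H_graph n ((n + l - 1) div 2) l}.
        num_cliques H r = max (h_r r n d l) (h_r r n ((n + l - 1) div 2) l))"
proof -
  define D where "D = (n + l - 1) div 2"
  interpret H1: H_parameters n d l using assms by unfold_locales linarith+
  interpret H2: H_parameters n D l using assms by unfold_locales (auto simp: D_def)
  have bound: "num_cliques G r \<le> max (h_r r n d l) (h_r r n D l) \<and>
      card (edges G) \<le> max (h n d l) (h n D l)"
    if G: "simple_graph G" "card (verts G) = n" "d \<le> min_degree G" "\<not> l_hamiltonian l G"
    for G :: "'a ugraph"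
  proof -
    \<comment> \<open>Stated for general \<open>q\<close> in order to be used for both
      \<open>r\<close> and 2.\<close>
    have "num_cliques G q \<le> max (h_r q n d l) (h_r q n D l)" if "0 < q" for q
      unfolding D_def
      by (rule num_cliques_le_if_not_l_hamiltonian[OF G(1,2,4,3) that assms(2,3)])
    then show ?thesis
      using assms(1) by (simp add: card_edges_eq_num_cliques[OF G(1)] h_eq_h_r)
  qed
  have "d \<le> min_degree (H_graph n D l)"
    using H2.min_degree_H assms(3) by (simp add: D_def)
  then have extremal: "\<forall>H \<in> {H_graph n d l, H_graph n D l}.
      simple_graph H \<and> card (verts H) = n \<and> d \<le> min_degree H \<and> \<not> l_hamiltonian l H"
    using H1.simple_graph_H H1.min_degree_H H1.not_l_hamiltonian_H
      H2.simple_graph_H H2.not_l_hamiltonian_H by simp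
  \<comment> \<open>Each graph attains its own \<open>h_r\<close> value, so the one with the larger
    value attains the maximum.\<close>
  have "\<exists>H \<in> {H_graph n d l, H_graph n D l}. num_cliques H r = max (h_r r n d l) (h_r r n D l)"
    using H1.num_cliques_H[OF assms(1)] H2.num_cliques_H[OF assms(1)] by (simp add: max_def)
  then show ?thesis
    unfolding D_def[symmetric] using bound extremal by blast
qed

end
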